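(* Let $\delta_n$ be the chromatic number of the $n$-dimensional simple permutoassociahedron $PA_n$ (with respect to proper colourings of its facets). When $n$ tends to infinity, $\delta_n\sim n\ln n$, i.e. $\lim_{n\to+\infty}\frac{\delta_n}{n\ln n}=1$.
   Context: For $n\geq 1$ let $[n]=\{1,\ldots,n\}$ and $[n]_0=\{0,1,\ldots,n\}$. For a family of sets $N$, an $N$-antichain is a subset $\{X_1,\ldots,X_m\}\subseteq N$ with $m\geq 2$ whose members are mutually incomparable with respect to $\subseteq$. A simple polytope $P$ realises a simplicial complex $K$ when the face lattice of $P$ with the bottom (the empty face) removed is isomorphic to $(K,\supseteq)$; then facets of $P$ correspond to the vertices of $K$, and two facets have a common vertex iff some simplex of $K$ contains both corresponding vertices. Simple permutoassociahedron. Let $C_1$ be the simplicial complex whose simplices are the sets $\{X_1,\ldots,X_l\}$ with $[n]_0\supset X_1\supset\cdots\supset X_l\supset\emptyset$ (strict inclusions), i.e. chains of nonempty proper subsets of $[n]_0$. Let $\mathcal{B}_1\subseteq C_1$ be the family of all sets of the form $$\bigl\{\{i_{k+l},\ldots,i_k,\ldots,i_1\},\ldots,\{i_{k+l},\ldots,i_k,i_{k-1}\},\{i_{k+l},\ldots,i_k\}\bigr\},$$ where $1\leq k\leq k+l\leq n$ and $i_1,\ldots,i_{k+l}$ are mutually distinct elements of $[n]_0$ (so each element of $\mathcal{B}_1$ is a chain of $k$ sets of consecutive cardinalities $l+1,\ldots,l+k$). A set $N\subseteq\mathcal{B}_1$ is a 1-nested set when the union of every $N$-antichain is an element of $C_1-\mathcal{B}_1$.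 The simplicial complex $C$ of all 1-nested sets is realised by a simple $n$-dimensional polytope, called the simple permutoassociahedron $PA_n$; its facets correspond to the elements of $\mathcal{B}_1$. Two facets of a polytope are separated when they have no vertex in common. For $\mathcal{F}$ the set of facets of a polytope, a function $f\colon\mathcal{F}\to[m]$ is a proper colouring when every two (distinct) facets of the same colour are separated. The chromatic number of the polytope is the minimal $m$ such that a proper colouring of its facets with $m$ colours exists. *)

theory Defs
  imports "HOL-Analysis.Analysis" "HOL-Analysis.Finite_Function_Topology"
begin

section \<open>Polytopes of arbitrary dimension in one vector space\<close>

text \<open>
  A limit over the dimension needs polytopes of all dimensions in a single type, so the
  ambient space of the final statement is the space \<^typ>\<open>nat \<Rightarrow>\<^sub>0 real\<close> of finitely supported
  real sequences, which contains every finite-dimensional real space. The library's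
  \<^const>\<open>polytope\<close>, \<^const>\<open>face_of\<close> and \<^const>\<open>extreme_point_of\<close> are available there, but its
  \<open>aff_dim\<close> and \<open>facet_of\<close> are restricted to Euclidean spaces. The next two definitions extend
  them; the two lemmas show that they agree on Euclidean spaces.
\<close>

definition has_aff_dim :: "'a::real_vector set \<Rightarrow> int \<Rightarrow> bool" where
  "has_aff_dim V d \<longleftrightarrow>
     (\<exists>B. finite B \<and> affine hull B = affine hull V \<and> \<not> affine_dependent B \<and> int (card B) = d + 1)"

definition is_facet :: "'a::real_vector set \<Rightarrow> 'a set \<Rightarrow> bool" where
  "is_facet F P \<longleftrightarrow>
     F face_of P \<and> F \<noteq> {} \<and> (\<exists>d. has_aff_dim P d \<and> has_aff_dim F (d - 1))"

lemma has_aff_dim_iff_aff_dim: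
  fixes V :: "'a::euclidean_space set"
  shows "has_aff_dim V d \<longleftrightarrow> aff_dim V = d"
proof
  assume "has_aff_dim V d"
  then show "aff_dim V = d"
    unfolding has_aff_dim_def by (metis aff_dim_unique add_right_cancel)
next
  assume "aff_dim V = d"
  then show "has_aff_dim V d"
    unfolding has_aff_dim_def
    using aff_dim_basis_exists[of V] aff_independent_finite by auto
qed

lemma is_facet_iff_facet_of:
  fixes P :: "'a::euclidean_space set"
  shows "is_facet F P \<longleftrightarrow> F facet_of P"
  by (auto simp: is_facet_def facet_of_def has_aff_dim_iff_aff_dim)

definition simple_polytope :: "nat \<Rightarrow> 'a::real_vector set \<Rightarrow> bool" where
  "simple_polytope n P \<longleftrightarrow>
     polytope P \<and> has_aff_dim P (int n) \<and>
     (\<forall>v. v extreme_point_of P \<longrightarrow> card {F. is_facet F P \<and> v \<in> F} = n)"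


section \<open>Chromatic number\<close>

definition separated_facets :: "'a::real_vector set \<Rightarrow> 'a set \<Rightarrow> 'a set \<Rightarrow> bool" where
  "separated_facets P F G \<longleftrightarrow> \<not> (\<exists>v. v extreme_point_of P \<and> v \<in> F \<and> v \<in> G)"

definition proper_colouring :: "'a::real_vector set \<Rightarrow> nat \<Rightarrow> ('a set \<Rightarrow> nat) \<Rightarrow> bool" where
  "proper_colouring P m f \<longleftrightarrow>
     f \<in> {F. is_facet F P} \<rightarrow> {1..m} \<and>
     (\<forall>F G. is_facet F P \<and> is_facet G P \<and> F \<noteq> G \<and> f F = f G \<longrightarrow> separated_facets P F G)"

definition chromatic_number :: "'a::real_vector set \<Rightarrow> nat" where
  "chromatic_number P = (LEAST m. \<exists>f. proper_colouring P m f)"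


section \<open>The simple permutoassociahedron\<close>

text \<open>
  Vertices of \<open>C\<^sub>1\<close> are subsets of \<open>{0..n}\<close> and its simplices are chains of such sets, so the
  elements of \<open>\<B>\<^sub>1\<close> have type \<^typ>\<open>nat set set\<close> and the sets \<open>N \<subseteq> \<B>\<^sub>1\<close> have type
  \<^typ>\<open>nat set set set\<close>. The empty simplex belongs to every complex here; in \<open>(K, \<supseteq>)\<close> it
  corresponds to the polytope itself.
\<close>

definition C1 :: "nat \<Rightarrow> nat set set set" where
  "C1 n = {\<X>. (\<forall>X\<in>\<X>. {} \<subset> X \<and> X \<subset> {0..n}) \<and> chain\<^sub>\<subseteq> \<X>}"

definition B1 :: "nat \<Rightarrow> nat set set set" where
  "B1 n = {(\<lambda>j. i ` {j..k + l}) ` {1..k} | (i :: nat \<Rightarrow> nat) k l.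
             1 \<le> k \<and> k + l \<le> n \<and> inj_on i {1..k + l} \<and> i ` {1..k + l} \<subseteq> {0..n}}"

definition antichain_in :: "'a set set \<Rightarrow> 'a set set \<Rightarrow> bool" where
  "antichain_in N A \<longleftrightarrow>
     A \<subseteq> N \<and> finite A \<and> 2 \<le> card A \<and> (\<forall>X\<in>A. \<forall>Y\<in>A. X \<noteq> Y \<longrightarrow> \<not> X \<subseteq> Y)"

definition nested1 :: "nat \<Rightarrow> nat set set set \<Rightarrow> bool" where
  "nested1 n N \<longleftrightarrow> N \<subseteq> B1 n \<and> (\<forall>A. antichain_in N A \<longrightarrow> \<Union>A \<in> C1 n - B1 n)"

definition realises :: "'a::real_vector set \<Rightarrow> 'b set set \<Rightarrow> bool" where
  "realises P K \<longleftrightarrow>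
     (\<exists>\<phi>. bij_betw \<phi> {F. F face_of P \<and> F \<noteq> {}} K \<and>
       (\<forall>F G. F face_of P \<and> F \<noteq> {} \<and> G face_of P \<and> G \<noteq> {} \<longrightarrow> (F \<subseteq> G \<longleftrightarrow> \<phi> F \<supseteq> \<phi> G)))"

text \<open>
  The permutoassociahedron is determined by its complex only up to combinatorial equivalence,
  so it is given as a predicate satisfied by each of its geometric realisations.
\<close>

definition simple_permutoassociahedron :: "nat \<Rightarrow> 'a::real_vector set \<Rightarrow> bool" where
  "simple_permutoassociahedron n P \<longleftrightarrow> simple_polytope n P \<and> realises P {N. nested1 n N}"

end

theory Submission
  imports Defs "HOL-Real_Asymp.Real_Asymp"
begin

text \<open>
  Two chains of \<open>\<B>\<^sub>1\<close> lie in a common nested set iff one contains the other, or their union is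
  a chain in which the sizes do not form an interval. An element of \<open>\<B>\<^sub>1\<close> is a saturated chain
  of subsets of \<open>{0..n}\<close>, so that its sizes form an interval \<open>{a..b}\<close> with \<open>1 \<le> a \<le> b \<le> n\<close>;
  for two incomparable chains to be compatible these intervals must be disjoint and not
  adjacent. The chromatic number is that of the compatibility graph on \<open>\<B>\<^sub>1\<close>, and it is
  squeezed between two bounds of size \<open>n ln n + O(n)\<close>.

  Upper bound. Two distinct chains of the same length \<open>s\<close> whose intervals overlap or are
  adjacent are incompatible. For each \<open>s\<close> the possible starting points of intervals are cut
  into blocks of \<open>s + 1\<close> consecutive numbers, and each block gets its own colour
  (\<open>proper_colouring_by_size_and_block\<close>). This uses at most
  \<open>\<Sum>s=1..n. (n + 1) / (s + 1) = (n + 1) (H\<^sub>n\<^sub>+\<^sub>1 - 1)\<close> colours, where \<open>H\<close> are the harmonic numbers.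

  Lower bound. In one fixed maximal flag the elements of \<open>\<B>\<^sub>1\<close> are just the intervals
  \<open>{a..b}\<close>, as for an associahedron. A colour class then consists of intervals any two of
  which cross or are adjacent, and such a family has at most \<open>s + 1\<close> members if it contains an
  interval of length \<open>s\<close> (\<open>card_crossing_intervals_le\<close>). Giving an interval of length \<open>s\<close> the
  weight \<open>1 / (s + 1)\<close>, every colour class has weight at most 1, so that the number of colours
  is at least the total weight
  \<open>\<Sum>s=1..n. (n + 1 - s) / (s + 1) = (n + 2) (H\<^sub>n\<^sub>+\<^sub>1 - 1) - n\<close>.

  The passage from the polytope to the complex is \<open>facets_of_realised_complex\<close>. A facet is a
  maximal proper face by a dimension count, so that it corresponds to a vertex of the complex.
  Conversely, simplicity gives \<open>n\<close> facets through each extreme point, while a nested set has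
  at most \<open>n\<close> elements (\<open>card_nested1_le\<close>); hence all elements of the nested set of an extreme
  point are facets, and every vertex of the complex occurs in such a set.
\<close>

section \<open>Faces and affine dimension in real vector spaces\<close>

text \<open>
  Collecting the positive and the negative coefficients of an affine combination \<open>x\<close> of points
  of the convex set \<open>F\<close> gives points \<open>z\<close> and \<open>y\<close> of \<open>F\<close> such that \<open>z\<close> lies between \<open>x\<close> and \<open>y\<close>;
  the face property then puts \<open>x\<close> into \<open>F\<close>. The argument is purely algebraic and so holds in
  every real vector space.
\<close>

lemma face_of_contains_affine_hull:
  fixes P :: "'a::real_vector set"
  assumes face: "F face_of P" and x: "x \<in> P" "x \<in> affine hull F"
  shows "x \<in> F"
proof -
  have "convex F" and sub: "F \<subseteq> P"
    using face by (auto simp: face_of_def)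
  obtain S u where S: "finite S" "S \<noteq> {}" "S \<subseteq> F" and u: "sum u S = 1" "(\<Sum>v\<in>S. u v *\<^sub>R v) = x"
    using x(2) unfolding affine_hull_explicit by blast
  define Q where "Q = {v\<in>S. u v \<ge> 0}"
  define R where "R = {v\<in>S. u v < 0}"
  define m where "m = (\<Sum>v\<in>R. - u v)"
  have split: "S = Q \<union> R" "Q \<inter> R = {}" "finite Q" "finite R"
    using S(1) by (auto simp: Q_def R_def)
  have m_Q: "sum u Q = 1 + m"
    using u(1) split by (simp add: sum.union_disjoint m_def sum_negf)
  have m0: "m \<ge> 0"
    unfolding m_def by (rule sum_nonneg) (auto simp: R_def)
  define z where "z = (\<Sum>v\<in>Q. (u v / (1 + m)) *\<^sub>R v)"
  have z: "z \<in> F"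
    unfolding z_def
  proof (rule convex_sum[OF split(3) \<open>convex F\<close>])
    show "(\<Sum>v\<in>Q. u v / (1 + m)) = 1"
      using m_Q m0 by (simp flip: sum_divide_distrib)
  qed (use S m0 in \<open>auto simp: Q_def\<close>)
  have x_eq: "x = (1 + m) *\<^sub>R z - (\<Sum>v\<in>R. (- u v) *\<^sub>R v)"
  proof -
    have "(1 + m) *\<^sub>R z = (\<Sum>v\<in>Q. u v *\<^sub>R v)"
      using m0 by (simp add: z_def scaleR_sum_right)
    then show ?thesis
      using u(2) split by (simp add: sum.union_disjoint sum_negf)
  qed
  show ?thesis
  proof (cases "m = 0")
    case True
    then have "R = {}"
      using split(4) unfolding m_def R_def by (subst (asm) sum_nonneg_eq_0_iff) auto
    then show ?thesis
      using x_eq True z by simp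
  next
    case False
    define y where "y = (\<Sum>v\<in>R. (- u v / m) *\<^sub>R v)"
    have y: "y \<in> F"
      unfolding y_def
    proof (rule convex_sum[OF split(4) \<open>convex F\<close>])
      show "(\<Sum>v\<in>R. - u v / m) = 1"
        using False by (simp only: m_def flip: sum_divide_distrib) simp
    qed (use S m0 in \<open>auto simp: R_def divide_le_0_iff\<close>)
    have "m *\<^sub>R y = (\<Sum>v\<in>R. (- u v) *\<^sub>R v)"
      using False by (simp add: y_def scaleR_sum_right)
    then have "(1 + m) *\<^sub>R z = x + m *\<^sub>R y"
      using x_eq by simp
    then have "z = (1 / (1 + m)) *\<^sub>R (x + m *\<^sub>R y)"
      using m0 by (metis (no_types, opaque_lifting) add_nonneg_eq_0_iff divide_self_if scaleR_one 
          scaleR_scaleR times_divide_eq_left mult_1 zero_le_one zero_neq_one)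
    moreover have "1 - m / (1 + m) = 1 / (1 + m)"
      using m0 by (simp add: field_simps)
    ultimately have "z = (1 - m / (1 + m)) *\<^sub>R x + (m / (1 + m)) *\<^sub>R y"
      by (simp add: scaleR_right_distrib)
    then have "x = y \<or> z \<in> open_segment x y"
      unfolding in_segment using m0 False
      by (metis add_0 add_strict_increasing2 divide_less_eq_1_pos divide_pos_pos less_add_same_cancel2
          order_le_less zero_less_one add_pos_pos)
    then show ?thesis
      using face_ofD[OF face] x(1) y z sub by blast
  qed
qed

lemma not_affine_dependent_insert:
  fixes S :: "'a::real_vector set"
  assumes ind: "\<not> affine_dependent S" and a: "a \<notin> affine hull S"
  shows "\<not> affine_dependent (insert a S)"
proof (cases "S = {}")
  case False
  then obtain b where b: "b \<in> S"
    by blast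
  define T where "T = (\<lambda>x. - b + x) ` (S - {b})"
  have ab: "a \<noteq> b"
    using a b hull_inc by metis
  have "independent T"
    using ind b affine_dependent_iff_dependent2 unfolding T_def by blast
  moreover have "affine hull S = (\<lambda>x. b + x) ` span T"
    using affine_hull_insert_span_gen[of b "S - {b}"] b by (simp add: T_def insert_absorb)
  then have "- b + a \<notin> span T"
    using a by (metis add_minus_cancel image_eqI)
  ultimately have "independent (insert (- b + a) T)"
    by (simp add: independent_insert)
  moreover have "insert (- b + a) T = (\<lambda>x. - b + x) ` (insert a S - {b})"
    using ab by (auto simp: T_def)
  ultimately show ?thesis
    using affine_dependent_iff_dependent2[of b "insert a S"] b by auto
qed auto

lemma card_affine_independent_le:
  fixes S B :: "'a::real_vector set"
  assumes B: "finite B" and S: "finite S" "\<not> affine_dependent S" "S \<subseteq> affine hull B"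
  shows "card S \<le> card B"
proof (cases "S = {}")
  case False
  then obtain a where a: "a \<in> S"
    by blast
  then have "B \<noteq> {}"
    using S(3) by auto
  then obtain b where b: "b \<in> B"
    by blast
  define T where "T = (\<lambda>x. - b + x) ` (B - {b})"
  have hull: "affine hull B = (\<lambda>x. b + x) ` span T"
    using affine_hull_insert_span_gen[of b "B - {b}"] b by (simp add: T_def insert_absorb)
  have "- a + s \<in> span T" if s: "s \<in> S" for s
  proof -
    obtain p q where "p \<in> span T" "q \<in> span T" "s = b + p" "a = b + q"
      using s a S(3) hull by blast
    then show ?thesis
      using span_diff[of p T q] by (simp add: algebra_simps)
  qed
  moreover have "independent ((\<lambda>x. - a + x) ` (S - {a}))"
    using S(2) a affine_dependent_iff_dependent2 by blast
  ultimately have "card ((\<lambda>x. - a + x) ` (S - {a})) \<le> card T"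
    using B independent_span_bound[of T "(\<lambda>x. - a + x) ` (S - {a})"] by (auto simp: T_def)
  moreover have "card T = card B - 1" "card ((\<lambda>x. - a + x) ` (S - {a})) = card S - 1"
    using a b by (auto simp: T_def card_image inj_on_def)
  ultimately show ?thesis
    using a b B S(1) by (metis card_gt_0_iff empty_iff le_diff_conv Suc_pred' Suc_eq_plus1 diff_le_mono)
qed auto

text \<open>
  If \<open>F \<subset> G \<subset> P\<close> were strict, an affine basis of \<open>F\<close> could be extended by a point of \<open>G\<close> and
  then by a point of \<open>P\<close>, each time leaving the affine hull of the smaller face. The result
  would have one point more than an affine basis of \<open>P\<close>.
\<close>

lemma facet_is_maximal_proper_face:
  fixes P :: "'a::real_vector set"
  assumes facet: "is_facet F P" and G: "G face_of P" "G \<noteq> P" "F \<subseteq> G"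
  shows "F = G"
proof (rule ccontr)
  assume "F \<noteq> G"
  then obtain g where g: "g \<in> G" "g \<notin> F"
    using G by blast
  obtain p where p: "p \<in> P" "p \<notin> G"
    using G face_of_imp_subset by blast
  have F: "F face_of P"
    using facet by (simp add: is_facet_def)
  obtain d A B where A: "finite A" "affine hull A = affine hull P" "int (card A) = d + 1"
    and B: "finite B" "affine hull B = affine hull F" "\<not> affine_dependent B" "int (card B) = d - 1 + 1"
    using facet unfolding is_facet_def has_aff_dim_def by blast
  have "g \<notin> affine hull B"
    using face_of_contains_affine_hull[OF F] face_of_imp_subset[OF G(1)] g B(2) by blast
  moreover have sub: "affine hull (insert g B) \<subseteq> affine hull G"
  proof (rule hull_minimal)
    show "insert g B \<subseteq> affine hull G"
      using g B(2) hull_mono[OF G(3), of affine] hull_subset[of B affine] hull_inc[of g G affine] by blast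
  qed simp
  then have "p \<notin> affine hull (insert g B)"
    using face_of_contains_affine_hull[OF G(1)] p by blast
  ultimately have ind: "\<not> affine_dependent (insert p (insert g B))"
    using B(3) not_affine_dependent_insert by blast
  have notin: "g \<notin> B" "p \<notin> insert g B"
    using \<open>g \<notin> affine hull B\<close> \<open>p \<notin> affine hull (insert g B)\<close> hull_inc by metis+
  have "insert p (insert g B) \<subseteq> affine hull A"
    using A(2) p(1) sub hull_mono[OF face_of_imp_subset[OF G(1)], of affine]
      hull_subset[of "insert g B" affine] hull_inc[of p P affine] by blast
  then have "card (insert p (insert g B)) \<le> card A"
    using card_affine_independent_le[OF A(1) _ ind] B(1) by simp
  then show False
    using A(3) B(1,4) notin by simp
qed

lemma facet_is_proper:
  assumes "is_facet F P"
  shows "F \<noteq> P"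
proof
  assume "F = P"
  then obtain d A B where A: "finite A" "affine hull A = affine hull P" "\<not> affine_dependent A" 
     "int (card A) = d + 1"
    and B: "finite B" "affine hull B = affine hull P" "int (card B) = d - 1 + 1"
    using assms unfolding is_facet_def has_aff_dim_def by blast
  have "card A \<le> card B"
    using card_affine_independent_le[OF B(1) A(1,3)] hull_subset[of A affine] A(2) B(2) by simp
  then show False
    using A(4) B(3) by simp
qed

text \<open>
  A point with positive weight in a convex combination \<open>x \<in> F\<close> is the endpoint of a segment of
  the polytope through \<open>x\<close>, whose other endpoint is the normalised rest of the combination. So
  all such points lie in \<open>F\<close>.
\<close>

lemma face_of_convex_hull_finite:
  fixes S :: "'a::real_vector set"
  assumes S: "finite S" and F: "F face_of (convex hull S)"
  shows "F = convex hull (S \<inter> F)"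
proof
  show "convex hull (S \<inter> F) \<subseteq> F"
    using F by (simp add: face_of_imp_convex hull_minimal)
  show "F \<subseteq> convex hull (S \<inter> F)"
  proof
    fix x assume x: "x \<in> F"
    then obtain u where u: "\<And>s. s \<in> S \<Longrightarrow> 0 \<le> u s" "sum u S = 1" "(\<Sum>s\<in>S. u s *\<^sub>R s) = x"
      using face_of_imp_subset[OF F] convex_hull_finite[OF S] by blast
    have "s \<in> F" if s: "s \<in> S" "u s \<noteq> 0" for s
    proof -
      have su: "sum u (S - {s}) = 1 - u s" "(\<Sum>t\<in>S - {s}. u t *\<^sub>R t) = x - u s *\<^sub>R s"
        using S s u(2,3) by (simp_all add: sum_diff1)
      have pos: "u s > 0"
        using u(1) s by fastforce
      show ?thesis
      proof (cases "u s = 1")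
        case True
        then have "\<And>t. t \<in> S - {s} \<Longrightarrow> u t = 0"
          using su(1) S u(1) sum_nonneg_eq_0_iff[of "S - {s}" u] by auto
        then have "(\<Sum>t\<in>S - {s}. u t *\<^sub>R t) = 0"
          by simp
        then show ?thesis
          using su(2) True x by simp
      next
        case False
        have "0 \<le> sum u (S - {s})"
          by (intro sum_nonneg) (use u in auto)
        then have less: "u s < 1"
          using False su(1) by simp
        define y where "y = (\<Sum>t\<in>S - {s}. (u t / (1 - u s)) *\<^sub>R t)"
        have "y \<in> convex hull S"
          unfolding y_def
        proof (rule convex_sum[OF _ convex_convex_hull])
          show "(\<Sum>t\<in>S - {s}. u t / (1 - u s)) = 1"
            using less su(1) by (simp flip: sum_divide_distrib)
        qed (use S u less in \<open>auto simp: hull_inc\<close>)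
        moreover have "(1 - u s) *\<^sub>R y = x - u s *\<^sub>R s"
          using less su(2) by (simp add: y_def scaleR_sum_right)
        then have "x = (1 - u s) *\<^sub>R y + u s *\<^sub>R s"
          by simp
        then have "y = s \<or> x \<in> open_segment y s"
          unfolding in_segment using pos less by blast
        ultimately show ?thesis
          using face_ofD[OF F] s(1) x \<open>x = (1 - u s) *\<^sub>R y + u s *\<^sub>R s\<close>
          by (metis hull_inc scaleR_collapse)
      qed
    qed
    then have zero: "u s = 0" if "s \<in> S - (S \<inter> F)" for s
      using that by blast
    have "(\<Sum>s\<in>S \<inter> F. u s) = sum u S" "(\<Sum>s\<in>S \<inter> F. u s *\<^sub>R s) = (\<Sum>s\<in>S. u s *\<^sub>R s)"
      using S zero by (intro sum.mono_neutral_left; force)+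
    then show "x \<in> convex hull (S \<inter> F)"
      using S u by (auto simp: convex_hull_finite)
  qed
qed

text \<open>
  Points that lie in the convex hull of the others are removed one at a time; once there are
  none left, every remaining point is extreme.
\<close>

lemma convex_hull_finite_has_extreme_point:
  fixes S :: "'a::real_vector set"
  assumes "finite S" "S \<noteq> {}"
  shows "\<exists>v. v extreme_point_of (convex hull S)"
  using assms
proof (induction rule: finite_psubset_induct)
  case (psubset S)
  show ?case
  proof (cases "\<exists>a\<in>S. a \<in> convex hull (S - {a})")
    case True
    then obtain a where a: "a \<in> S" "a \<in> convex hull (S - {a})"
      by blast
    then have "convex hull S = convex hull (S - {a})"
      by (metis hull_redundant insert_Diff)
    moreover have "S - {a} \<noteq> {}"
      using a(2) by (metis convex_hull_empty empty_iff)
    ultimately show ?thesis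
      using psubset.IH[of "S - {a}"] a(1) by auto
  next
    case False
    obtain a where a: "a \<in> S"
      using psubset.prems by blast
    then show ?thesis
      using False extreme_point_of_convex_hull_insert[of "S - {a}" a] psubset.hyps
      by (auto simp: insert_absorb)
  qed
qed

lemma nonempty_face_has_extreme_point:
  fixes P :: "'a::real_vector set"
  assumes "polytope P" "F face_of P" "F \<noteq> {}"
  obtains v where "v extreme_point_of P" "v \<in> F"
proof -
  obtain S where S: "finite S" "P = convex hull S"
    using assms(1) unfolding polytope_def by blast
  have F: "F = convex hull (S \<inter> F)"
    using face_of_convex_hull_finite S assms(2) by blast
  then have "S \<inter> F \<noteq> {}"
    using assms(3) by force
  then obtain v where "v extreme_point_of F"
    using convex_hull_finite_has_extreme_point[of "S \<inter> F"] S(1) F by auto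
  then show thesis
    using that extreme_point_of_face[OF assms(2)] by blast
qed

text \<open>
  The faces that realise vertices of \<open>K\<close> have codimension one by a counting argument: \<open>n\<close> facets
  pass through an extreme point \<open>v\<close>, distinct facets belong to distinct elements of the simplex
  realised by \<open>{v}\<close>, and this simplex has at most \<open>n\<close> elements. So each of its elements belongs
  to a facet.
\<close>

lemma facets_of_realised_complex:
  fixes P :: "'a::real_vector set" and K :: "'b set set"
  assumes P: "simple_polytope n P" and real: "realises P K"
    and empty: "{} \<in> K"
    and down: "\<And>M N. N \<in> K \<Longrightarrow> M \<subseteq> N \<Longrightarrow> M \<in> K"
    and fin: "\<And>N. N \<in> K \<Longrightarrow> finite N"
    and card: "\<And>N. N \<in> K \<Longrightarrow> card N \<le> n"
  obtains \<psi> where "bij_betw \<psi> {x. {x} \<in> K} {F. is_facet F P}"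
    and "\<And>x y. {x} \<in> K \<Longrightarrow> {y} \<in> K \<Longrightarrow> separated_facets P (\<psi> x) (\<psi> y) \<longleftrightarrow> {x, y} \<notin> K"
proof -
  define \<F> where "\<F> = {F. F face_of P \<and> F \<noteq> {}}"
  obtain \<phi> where bij: "bij_betw \<phi> \<F> K"
    and ord: "\<And>F G. F \<in> \<F> \<Longrightarrow> G \<in> \<F> \<Longrightarrow> F \<subseteq> G \<longleftrightarrow> \<phi> G \<subseteq> \<phi> F"
    using real unfolding realises_def \<F>_def by auto
  define \<theta> where "\<theta> = inv_into \<F> \<phi>"
  have \<theta>: "\<theta> N \<in> \<F>" "\<phi> (\<theta> N) = N" if "N \<in> K" for N
    using bij that unfolding \<theta>_def bij_betw_def by (auto intro: inv_into_into f_inv_into_f)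
  have \<theta>\<phi>: "\<theta> (\<phi> F) = F" "\<phi> F \<in> K" if "F \<in> \<F>" for F
    using bij that unfolding \<theta>_def bij_betw_def by auto
  have "polytope P"
    using P by (simp add: simple_polytope_def)
  have "convex P"
    using \<open>polytope P\<close> by (auto simp: polytope_def)
  have sub: "\<theta> {} \<subseteq> P" and "\<theta> {} \<noteq> {}"
    using \<theta>(1)[OF empty] face_of_imp_subset unfolding \<F>_def by auto
  then have "P \<noteq> {}"
    by auto
  then have P_in: "P \<in> \<F>"
    using face_of_refl[OF \<open>convex P\<close>] by (simp add: \<F>_def)
  have \<theta>_empty: "\<theta> {} = P"
  proof -
    have "\<phi> P \<subseteq> {}"
      using sub ord[OF \<theta>(1)[OF empty] P_in] \<theta>(2)[OF empty] by simp
    then show ?thesis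
      using \<theta>\<phi>[OF P_in] by simp
  qed
  define \<psi> where "\<psi> x = \<theta> {x}" for x
  have proper: "\<psi> x \<noteq> P" if "{x} \<in> K" for x
    using \<theta>(2)[OF that] \<theta>(2)[OF empty] \<theta>_empty unfolding \<psi>_def by fastforce
  \<comment> \<open>\<open>\<phi> {v}\<close> is the maximal simplex of the extreme point \<open>v\<close>; the faces containing \<open>v\<close> are its subsets.\<close>
  have vertex: "v \<in> \<psi> x \<longleftrightarrow> x \<in> \<phi> {v}" "{v} \<in> \<F>"
    if "v extreme_point_of P" "{x} \<in> K" for v x
  proof -
    show v: "{v} \<in> \<F>"
      using that by (simp add: \<F>_def face_of_singleton)
    show "v \<in> \<psi> x \<longleftrightarrow> x \<in> \<phi> {v}"
      using ord[OF v \<theta>(1)[OF that(2)]] \<theta>(2)[OF that(2)] by (simp add: \<psi>_def)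
  qed
  have facet_singleton: "\<exists>x\<in>\<phi> F. {x} \<in> K \<and> F = \<psi> x" if facet: "is_facet F P" for F
  proof -
    have F: "F \<in> \<F>"
      using facet by (simp add: is_facet_def \<F>_def)
    have "\<phi> F \<noteq> {}"
      using facet_is_proper[OF facet] \<theta>\<phi>[OF F] \<theta>_empty by auto
    then obtain x where x: "x \<in> \<phi> F"
      by blast
    then have xK: "{x} \<in> K"
      using down[OF \<theta>\<phi>(2)[OF F]] by blast
    then have "F \<subseteq> \<psi> x"
      using ord[OF F \<theta>(1)[OF xK]] \<theta>(2)[OF xK] x by (simp add: \<psi>_def)
    moreover have "\<psi> x face_of P"
      using \<theta>(1)[OF xK] by (simp add: \<psi>_def \<F>_def)
    ultimately show ?thesis
      using facet_is_maximal_proper_face[OF facet _ proper[OF xK]] x xK by blast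
  qed
  have vertex_facet: "is_facet (\<psi> x) P" if xK: "{x} \<in> K" for x
  proof -
    obtain v where v: "v extreme_point_of P" "v \<in> \<psi> x"
      using nonempty_face_has_extreme_point[OF \<open>polytope P\<close>] \<theta>(1)[OF xK] unfolding \<F>_def \<psi>_def by blast
    have N: "\<phi> {v} \<in> K"
      using vertex(2)[OF v(1) xK] \<theta>\<phi> by blast
    have "{F. is_facet F P \<and> v \<in> F} \<subseteq> \<psi> ` \<phi> {v}"
      using facet_singleton vertex(1)[OF v(1)] by blast
    moreover have "card (\<psi> ` \<phi> {v}) \<le> card {F. is_facet F P \<and> v \<in> F}"
      using P v(1) card_image_le[OF fin[OF N], of \<psi>] card[OF N] by (simp add: simple_polytope_def)
    ultimately have "{F. is_facet F P \<and> v \<in> F} = \<psi> ` \<phi> {v}"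
      using fin[OF N] by (intro card_seteq) auto
    then show ?thesis
      using vertex(1)[OF v(1) xK] v(2) by blast
  qed
  show thesis
  proof
    have "inj_on \<psi> {x. {x} \<in> K}"
      using \<theta>(2) unfolding \<psi>_def by (metis (mono_tags, lifting) inj_onI mem_Collect_eq singleton_inject)
    then show "bij_betw \<psi> {x. {x} \<in> K} {F. is_facet F P}"
      using facet_singleton vertex_facet unfolding bij_betw_def by blast
  next
    fix x y assume x: "{x} \<in> K" and y: "{y} \<in> K"
    have "{x, y} \<in> K" if v: "v extreme_point_of P" "v \<in> \<psi> x" "v \<in> \<psi> y" for v
      using vertex[OF v(1) x] vertex[OF v(1) y] \<theta>\<phi>(2) v down by (metis empty_subsetI insert_subset)
    moreover have "\<exists>v. v extreme_point_of P \<and> v \<in> \<psi> x \<and> v \<in> \<psi> y" if xy: "{x, y} \<in> K"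
    proof -
      obtain v where "v extreme_point_of P" "v \<in> \<theta> {x, y}"
        using nonempty_face_has_extreme_point[OF \<open>polytope P\<close>] \<theta>(1)[OF xy] unfolding \<F>_def by blast
      moreover have "\<theta> {x, y} \<subseteq> \<psi> x" "\<theta> {x, y} \<subseteq> \<psi> y"
        using ord[OF \<theta>(1)[OF xy] \<theta>(1)[OF x]] ord[OF \<theta>(1)[OF xy] \<theta>(1)[OF y]] \<theta>(2)[OF xy] \<theta>(2)[OF x] \<theta>(2)[OF y]
        by (simp_all add: \<psi>_def)
      ultimately show ?thesis
        by blast
    qed
    ultimately show "separated_facets P (\<psi> x) (\<psi> y) \<longleftrightarrow> {x, y} \<notin> K"
      unfolding separated_facets_def by blast
  qed
qed

section \<open>Saturated chains\<close>

lemma chain_subset_if_card_le: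
  assumes "chain\<^sub>\<subseteq> X" "\<forall>S\<in>X. finite S" "A \<in> X" "B \<in> X" "card A \<le> card B"
  shows "A \<subseteq> B"
  using assms unfolding chain_subset_def by (metis card_seteq order_refl)

lemma chain_inj_on_card:
  assumes "chain\<^sub>\<subseteq> X" "\<forall>S\<in>X. finite S"
  shows "inj_on card X"
  using chain_subset_if_card_le[OF assms] by (intro inj_onI) (metis order_refl subset_antisym)

lemma enumerate_saturated_chain:
  fixes T :: "nat \<Rightarrow> 'a set"
  assumes "a \<le> b"
    and "\<And>c. a \<le> c \<Longrightarrow> c \<le> b \<Longrightarrow> finite (T c) \<and> card (T c) = c"
    and "\<And>c. a \<le> c \<Longrightarrow> c < b \<Longrightarrow> T c \<subseteq> T (Suc c)"
  shows "\<exists>h. inj_on h {1..b} \<and> (\<forall>c\<in>{a..b}. h ` {1..c} = T c)"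
  using assms
proof (induction b rule: dec_induct)
  case base
  then obtain h where "bij_betw h {1..a} (T a)"
    using finite_same_card_bij[of "{1..a}" "T a"] by auto
  then show ?case
    by (auto simp: bij_betw_def)
next
  case (step b)
  then obtain h where h: "inj_on h {1..b}" "\<forall>c\<in>{a..b}. h ` {1..c} = T c"
    by (metis Suc_leD le_SucI less_Suc_eq)
  have T: "T b \<subseteq> T (Suc b)" "card (T b) = b" "card (T (Suc b)) = Suc b" "finite (T b)"
    using step by auto
  then have "card (T (Suc b) - T b) = 1"
    by (simp add: card_Diff_subset)
  then obtain x where x: "T (Suc b) - T b = {x}"
    by (rule card_1_singletonE)
  define h' where "h' = h(Suc b := x)"
  have img: "h' ` {1..c} = h ` {1..c}" if "c \<le> b" for c
    using that by (auto simp: h'_def)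
  have hb: "h ` {1..b} = T b"
    using h(2) step.hyps by auto
  have Suc_img: "{1..Suc b} = insert (Suc b) {1..b}"
    by auto
  have "inj_on h {1..b} = inj_on h' {1..b}"
    by (rule inj_on_cong) (simp add: h'_def)
  then have "inj_on h' {1..Suc b}"
    using h(1) img[of b] hb x unfolding Suc_img by (auto simp: h'_def)
  moreover have "h' ` {1..Suc b} = insert (h' (Suc b)) (h' ` {1..b})"
    unfolding Suc_img by simp
  then have "h' ` {1..Suc b} = T (Suc b)"
    using img[of b] hb x T(1) by (auto simp: h'_def)
  then have "\<forall>c\<in>{a..Suc b}. h' ` {1..c} = T c"
    using h(2) img by (metis atLeastAtMost_iff le_Suc_eq)
  ultimately show ?case
    by blast
qed

text \<open>
  Written in this way, membership of a chain in \<open>\<B>\<^sub>1\<close> is a condition on its sizes alone, which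
  is how unions of chains are tested below. In the definition the sets are the final segments
  \<open>i ` {j..k + l}\<close>. An enumeration \<open>h\<close> that grows with the chain, one element at a time, gives
  them as initial segments; the required \<open>i\<close> is \<open>h\<close> read backwards.
\<close>

lemma B1_iff_saturated_chain:
  "X \<in> B1 n \<longleftrightarrow> chain\<^sub>\<subseteq> X \<and> X \<subseteq> Pow {0..n} \<and>
     (\<exists>a b. 1 \<le> a \<and> a \<le> b \<and> b \<le> n \<and> card ` X = {a..b})"
proof
  assume "X \<in> B1 n"
  then obtain i :: "nat \<Rightarrow> nat" and k l where X: "X = (\<lambda>j. i ` {j..k + l}) ` {1..k}"
    and kl: "1 \<le> k" "k + l \<le> n" and i: "inj_on i {1..k + l}" "i ` {1..k + l} \<subseteq> {0..n}"
    unfolding B1_def by blast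
  have "chain\<^sub>\<subseteq> X"
  proof -
    have "i ` {p..k + l} \<subseteq> i ` {q..k + l}" if "q \<le> p" for p q
      using that by (intro image_mono) auto
    then show ?thesis
      unfolding X chain_subset_def by (intro ballI, elim imageE) (metis nat_le_linear)
  qed
  moreover have "X \<subseteq> Pow {0..n}"
  proof -
    have "i ` {j..k + l} \<subseteq> {0..n}" if "1 \<le> j" for j
    proof -
      have "i ` {j..k + l} \<subseteq> i ` {1..k + l}"
        using that by (intro image_mono) auto
      then show ?thesis
        using i(2) by blast
    qed
    then show ?thesis
      unfolding X by fastforce
  qed
  moreover have "card ` X = {l + 1..k + l}"
  proof -
    have "card (i ` {j..k + l}) = k + l + 1 - j" if "j \<in> {1..k}" for j
    proof -
      have "inj_on i {j..k + l}"
        using that by (intro inj_on_subset[OF i(1)]) auto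
      then show ?thesis
        by (simp add: card_image)
    qed
    then have "card ` X = (\<lambda>j. k + l + 1 - j) ` {1..k}"
      unfolding X image_image by (rule image_cong[OF refl])
    also have "\<dots> = {l + 1..k + l}"
    proof
      show "{l + 1..k + l} \<subseteq> (\<lambda>j. k + l + 1 - j) ` {1..k}"
      proof
        fix s assume "s \<in> {l + 1..k + l}"
        then have "s = k + l + 1 - (k + l + 1 - s)" "k + l + 1 - s \<in> {1..k}"
          by auto
        then show "s \<in> (\<lambda>j. k + l + 1 - j) ` {1..k}"
          by blast
      qed
    qed auto
    finally show ?thesis .
  qed
  ultimately show "chain\<^sub>\<subseteq> X \<and> X \<subseteq> Pow {0..n} \<and>
     (\<exists>a b. 1 \<le> a \<and> a \<le> b \<and> b \<le> n \<and> card ` X = {a..b})"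
    using kl by (intro conjI exI[of _ "l + 1"] exI[of _ "k + l"]) auto
next
  assume asm: "chain\<^sub>\<subseteq> X \<and> X \<subseteq> Pow {0..n} \<and>
     (\<exists>a b. 1 \<le> a \<and> a \<le> b \<and> b \<le> n \<and> card ` X = {a..b})"
  then obtain a b where ab: "1 \<le> a" "a \<le> b" "b \<le> n" and sizes: "card ` X = {a..b}"
    by blast
  have chain: "chain\<^sub>\<subseteq> X" and sub: "X \<subseteq> Pow {0..n}"
    using asm by simp_all
  then have fin: "\<forall>S\<in>X. finite S"
    by (meson PowD finite_atLeastAtMost finite_subset subsetD)
  have "\<forall>c\<in>{a..b}. \<exists>S\<in>X. card S = c"
    using sizes by (metis imageE)
  then obtain T where T: "\<And>c. c \<in> {a..b} \<Longrightarrow> T c \<in> X \<and> card (T c) = c"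
    by metis
  have X_eq: "X = T ` {a..b}"
  proof
    show "X \<subseteq> T ` {a..b}"
    proof
      fix S assume S: "S \<in> X"
      then have c: "card S \<in> {a..b}"
        using sizes by blast
      then have "S = T (card S)"
        using T[OF c] S inj_onD[OF chain_inj_on_card[OF chain fin], of S "T (card S)"] by simp
      then show "S \<in> T ` {a..b}"
        using c by blast
    qed
  qed (use T in blast)
  obtain h where h: "inj_on h {1..b}" "\<And>c. c \<in> {a..b} \<Longrightarrow> h ` {1..c} = T c"
  proof -
    have "\<exists>h. inj_on h {1..b} \<and> (\<forall>c\<in>{a..b}. h ` {1..c} = T c)"
    proof (rule enumerate_saturated_chain[OF ab(2)])
      show "finite (T c) \<and> card (T c) = c" if "a \<le> c" "c \<le> b" for c
        using T[of c] that fin by simp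
      show "T c \<subseteq> T (Suc c)" if "a \<le> c" "c < b" for c
        using chain_subset_if_card_le[OF chain fin, of "T c" "T (Suc c)"] T[of c] T[of "Suc c"] that by simp
    qed
    then show thesis
      using that by blast
  qed
  define i where "i m = h (b + 1 - m)" for m
  define k where "k = b + 1 - a"
  define l where "l = a - 1"
  have kl: "k + l = b" "1 \<le> k"
    using ab by (auto simp: k_def l_def)
  have flip: "(\<lambda>m. b + 1 - m) ` {j..b} = {1..b + 1 - j}" if "1 \<le> j" for j
  proof
    show "{1..b + 1 - j} \<subseteq> (\<lambda>m. b + 1 - m) ` {j..b}"
    proof
      fix s assume "s \<in> {1..b + 1 - j}"
      then have "s = b + 1 - (b + 1 - s)" "b + 1 - s \<in> {j..b}"
        using that by auto
      then show "s \<in> (\<lambda>m. b + 1 - m) ` {j..b}"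
        by blast
    qed
  qed (use that in auto)
  have i_img: "i ` {j..b} = h ` {1..b + 1 - j}" if "1 \<le> j" for j
    unfolding i_def flip[OF that, symmetric] image_image ..
  have "inj_on i {1..b}"
  proof (rule inj_onI)
    fix p q assume pq: "p \<in> {1..b}" "q \<in> {1..b}" "i p = i q"
    have "b + 1 - p \<in> {1..b}" "b + 1 - q \<in> {1..b}"
      using pq by auto
    then have "b + 1 - p = b + 1 - q"
      using inj_onD[OF h(1), of "b + 1 - p" "b + 1 - q"] pq(3) unfolding i_def by blast
    then show "p = q"
      using pq by auto
  qed
  moreover have "i ` {1..b} \<subseteq> {0..n}"
  proof -
    have "i ` {1..b} = T b"
      using i_img[of 1] h(2)[of b] ab by simp
    then show ?thesis
      using T[of b] ab sub by auto
  qed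
  moreover have "X = (\<lambda>j. i ` {j..b}) ` {1..k}"
  proof -
    have "(\<lambda>j. i ` {j..b}) ` {1..k} = (\<lambda>j. T (b + 1 - j)) ` {1..k}"
    proof (rule image_cong[OF refl])
      fix j assume "j \<in> {1..k}"
      then have j: "1 \<le> j" "b + 1 - j \<in> {a..b}"
        using ab by (auto simp: k_def)
      then show "i ` {j..b} = T (b + 1 - j)"
        using i_img h(2) by simp
    qed
    also have "\<dots> = T ` (\<lambda>j. b + 1 - j) ` {1..k}"
      by (simp add: image_image)
    also have "(\<lambda>j. b + 1 - j) ` {1..k} = {a..b}"
    proof
      show "{a..b} \<subseteq> (\<lambda>j. b + 1 - j) ` {1..k}"
      proof
        fix s assume "s \<in> {a..b}"
        then have "s = b + 1 - (b + 1 - s)" "b + 1 - s \<in> {1..k}"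
          by (auto simp: k_def)
        then show "s \<in> (\<lambda>j. b + 1 - j) ` {1..k}"
          by blast
      qed
    qed (use ab in \<open>auto simp: k_def\<close>)
    finally show ?thesis
      using X_eq by simp
  qed
  ultimately show "X \<in> B1 n"
    unfolding B1_def mem_Collect_eq using kl ab(3)
    by (intro exI[of _ i] exI[of _ k] exI[of _ l]) simp
qed

lemma B1_obtain_sizes:
  assumes "X \<in> B1 n"
  obtains a b where "1 \<le> a" "a \<le> b" "b \<le> n" "card ` X = {a..b}" "card X = b + 1 - a" "Min (card ` X) = a"
proof -
  obtain a b where ab: "1 \<le> a" "a \<le> b" "b \<le> n" "card ` X = {a..b}"
    and X: "chain\<^sub>\<subseteq> X" "X \<subseteq> Pow {0..n}"
    using assms B1_iff_saturated_chain by auto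
  have "inj_on card X"
    using X by (intro chain_inj_on_card) (auto intro: finite_subset)
  then have "card X = b + 1 - a"
    using ab(4) card_image by fastforce
  moreover have "Min (card ` X) = a"
    using ab(2) unfolding ab(4) by (intro Min_eqI) auto
  ultimately show thesis
    using that ab by blast
qed

lemma finite_B1: "finite (B1 n)"
proof (rule finite_subset)
  show "B1 n \<subseteq> Pow (Pow {0..n})"
    using B1_iff_saturated_chain by blast
qed simp

lemma B1_finite: "X \<in> B1 n \<Longrightarrow> finite X"
  by (rule finite_subset[of _ "Pow {0..n}"]) (simp_all add: B1_iff_saturated_chain)

lemma B1_nonempty: "X \<in> B1 n \<Longrightarrow> X \<noteq> {}"
  by (auto simp: B1_iff_saturated_chain)

lemma B1_Un_in_B1:
  assumes X: "X \<in> B1 n" "card ` X = {a..b}" and Y: "Y \<in> B1 n" "card ` Y = {c..d}"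
    and chain: "chain\<^sub>\<subseteq> (X \<union> Y)" and overlap: "c \<le> b + 1" "a \<le> d + 1"
  shows "X \<union> Y \<in> B1 n"
proof -
  have a: "1 \<le> a" "a \<le> b" "b \<le> n" and c: "1 \<le> c" "c \<le> d" "d \<le> n"
    using X Y by (auto elim!: B1_obtain_sizes)
  have "card ` (X \<union> Y) = {min a c..max b d}"
    unfolding image_Un X(2) Y(2) using a c overlap by auto
  moreover have "X \<union> Y \<subseteq> Pow {0..n}"
    using X(1) Y(1) by (simp add: B1_iff_saturated_chain)
  ultimately show ?thesis
    using chain a c unfolding B1_iff_saturated_chain
    by (intro conjI exI[of _ "min a c"] exI[of _ "max b d"]) auto
qed

section \<open>Nested sets\<close>

lemma B1_subset_C1: "B1 n \<subseteq> C1 n"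
proof
  fix X assume X: "X \<in> B1 n"
  obtain a b where ab: "1 \<le> a" "b \<le> n" "card ` X = {a..b}"
    using B1_obtain_sizes[OF X] by metis
  have "{} \<subset> S \<and> S \<subset> {0..n}" if S: "S \<in> X" for S
  proof -
    have "card S \<in> {a..b}"
      using S ab(3) by blast
    then have "card S \<noteq> 0" "card S \<noteq> card {0..n}"
      using ab by auto
    moreover have "S \<subseteq> {0..n}"
      using S X by (auto simp: B1_iff_saturated_chain)
    ultimately show ?thesis
      by auto
  qed
  then show "X \<in> C1 n"
    using X by (auto simp: C1_def B1_iff_saturated_chain)
qed

lemma nested1_mono: "nested1 n N \<Longrightarrow> M \<subseteq> N \<Longrightarrow> nested1 n M"
  unfolding nested1_def antichain_in_def by (meson subset_trans)

lemma nested1_pair_iff: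
  assumes "X \<in> B1 n" "Y \<in> B1 n"
  shows "nested1 n {X, Y} \<longleftrightarrow> X \<subseteq> Y \<or> Y \<subseteq> X \<or> X \<union> Y \<in> C1 n - B1 n"
proof (cases "X \<subseteq> Y \<or> Y \<subseteq> X")
  case True
  have "\<not> antichain_in {X, Y} A" for A
  proof
    assume A: "antichain_in {X, Y} A"
    then have "A = {X, Y}"
      using card_seteq[of "{X, Y}" A] by (simp add: antichain_in_def card_insert_if)
    then show False
      using A True by (cases "X = Y") (auto simp: antichain_in_def)
  qed
  then show ?thesis
    unfolding nested1_def using True assms by blast
next
  case False
  then have "X \<noteq> Y"
    by blast
  then have "antichain_in {X, Y} {X, Y}"
    using False by (auto simp: antichain_in_def)
  moreover have "A = {X, Y}" if "antichain_in {X, Y} A" for A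
    using that \<open>X \<noteq> Y\<close> card_seteq[of "{X, Y}" A] by (simp add: antichain_in_def)
  ultimately have "antichain_in {X, Y} A \<longleftrightarrow> A = {X, Y}" for A
    by blast
  then show ?thesis
    using False assms by (simp add: nested1_def)
qed

lemma nested1_singleton_iff: "nested1 n {X} \<longleftrightarrow> X \<in> B1 n"
  using nested1_pair_iff[of X n X] unfolding nested1_def by auto

lemma nested1_finite: "nested1 n N \<Longrightarrow> finite N"
  unfolding nested1_def by (elim conjE, rule finite_subset[OF _ finite_B1])

lemma nested1_Union_chain:
  assumes N: "nested1 n N"
  shows "chain\<^sub>\<subseteq> (\<Union>N)"
  unfolding chain_subset_def
proof (intro ballI)
  fix S T assume "S \<in> \<Union>N" "T \<in> \<Union>N"
  then obtain X Y where XY: "X \<in> N" "S \<in> X" "Y \<in> N" "T \<in> Y"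
    by blast
  then have B: "X \<in> B1 n" "Y \<in> B1 n"
    using N by (auto simp: nested1_def)
  have "nested1 n {X, Y}"
    using nested1_mono[OF N] XY by simp
  then consider "X \<union> Y = Y" | "X \<union> Y = X" | "X \<union> Y \<in> C1 n"
    using nested1_pair_iff[OF B] by blast
  then have "X \<union> Y \<in> C1 n"
    using B B1_subset_C1 by cases auto
  then show "S \<subseteq> T \<or> T \<subseteq> S"
    using XY by (auto simp: C1_def chain_subset_def)
qed

text \<open>
  The maximal members of \<open>N\<close> strictly below \<open>X\<close> form an antichain, whose union is not in \<open>\<B>\<^sub>1\<close>
  and hence is not \<open>X\<close>; if there is at most one of them, it is too small to be \<open>X\<close>.
\<close>

lemma nested1_not_covered:
  assumes N: "nested1 n N" and X: "X \<in> N"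
  shows "\<exists>S\<in>X. \<forall>Y\<in>N. Y \<subset> X \<longrightarrow> S \<notin> Y"
proof (rule ccontr)
  assume contr: "\<not> ?thesis"
  define D where "D = {Y\<in>N. Y \<subset> X}"
  define M where "M = {Y\<in>D. \<forall>Z\<in>D. Y \<subseteq> Z \<longrightarrow> Y = Z}"
  have XB: "X \<in> B1 n"
    using N X by (auto simp: nested1_def)
  have "finite D"
    using nested1_finite[OF N] by (simp add: D_def)
  have "\<exists>Z\<in>M. Y \<subseteq> Z" if Y: "Y \<in> D" for Y
    using finite_has_maximal2[OF \<open>finite D\<close> Y] unfolding M_def by auto
  moreover have "X \<subseteq> \<Union>D"
    using contr unfolding D_def by blast
  moreover have "\<Union>M \<subseteq> X"
    unfolding M_def D_def by auto
  ultimately have "\<Union>M = X"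
    by blast
  moreover have "\<Union>M \<notin> B1 n" if "2 \<le> card M"
  proof -
    have "antichain_in N M"
      unfolding antichain_in_def
    proof (intro conjI)
      show "finite M"
        using \<open>finite D\<close> by (simp add: M_def)
    qed (use that in \<open>auto simp: M_def D_def\<close>)
    then show ?thesis
      using N by (auto simp: nested1_def)
  qed
  moreover have "\<Union>M \<noteq> X" if "card M < 2"
  proof -
    have "finite M"
      using \<open>finite D\<close> by (simp add: M_def)
    then have "M = {} \<or> (\<exists>Y. M = {Y})"
      using that by (metis One_nat_def card_1_singletonE card_eq_0_iff less_2_cases)
    moreover have "Y \<subset> X" if "Y \<in> M" for Y
      using that by (simp add: M_def D_def)
    ultimately show ?thesis
      using B1_nonempty[OF XB] by fastforce
  qed
  ultimately show False
    using XB by (cases "2 \<le> card M") auto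
qed

text \<open>
  A nested set injects into the chain \<open>\<Union>N\<close>, whose sets have sizes in \<open>{1..n}\<close>: each \<open>X \<in> N\<close>
  is mapped to a set \<open>g X\<close> not covered by smaller members. If \<open>g X = g Y\<close>, then \<open>X\<close> and \<open>Y\<close> are
  comparable, since otherwise their union would be a saturated chain, and comparable members
  with the same value of \<open>g\<close> are equal.
\<close>

lemma card_nested1_le:
  assumes N: "nested1 n N"
  shows "card N \<le> n"
proof -
  obtain g where g: "\<And>X. X \<in> N \<Longrightarrow> g X \<in> X" "\<And>X Y. X \<in> N \<Longrightarrow> Y \<in> N \<Longrightarrow> Y \<subset> X \<Longrightarrow> g X \<notin> Y"
    using nested1_not_covered[OF N] by metis
  have NB: "X \<in> B1 n" if "X \<in> N" for X
    using N that by (auto simp: nested1_def)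
  have "inj_on g N"
  proof (rule inj_onI)
    fix X Y assume X: "X \<in> N" and Y: "Y \<in> N" and eq: "g X = g Y"
    obtain a b where a: "card ` X = {a..b}"
      using B1_obtain_sizes[OF NB[OF X]] by metis
    obtain c d where c: "card ` Y = {c..d}"
      using B1_obtain_sizes[OF NB[OF Y]] by metis
    have "card (g X) \<in> {a..b}" "card (g X) \<in> {c..d}"
      using g(1)[OF X] g(1)[OF Y] a c eq by auto
    then have "c \<le> b + 1" "a \<le> d + 1"
      by auto
    then have "X \<union> Y \<notin> C1 n - B1 n"
      using B1_Un_in_B1[OF NB[OF X] a NB[OF Y] c] by (auto simp: C1_def)
    moreover have "nested1 n {X, Y}"
      using nested1_mono[OF N] X Y by simp
    ultimately have "X \<subseteq> Y \<or> Y \<subseteq> X"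
      using nested1_pair_iff NB X Y by blast
    then show "X = Y"
      using g(1)[OF X] g(1)[OF Y] g(2)[OF X Y] g(2)[OF Y X] eq by auto
  qed
  have C: "{} \<subset> S \<and> S \<subset> {0..n}" if S: "S \<in> \<Union>N" for S
  proof -
    obtain X where "S \<in> X" "X \<in> C1 n"
      using S NB B1_subset_C1 by blast
    then show ?thesis
      unfolding C1_def by blast
  qed
  have "finite S" if "S \<in> \<Union>N" for S
    using C[OF that] finite_subset[of S "{0..n}"] by auto
  then have inj: "inj_on card (\<Union>N)"
    by (intro chain_inj_on_card[OF nested1_Union_chain[OF N]] ballI)
  have sizes: "card ` \<Union>N \<subseteq> {1..n}"
  proof
    fix s assume "s \<in> card ` \<Union>N"
    then obtain S where S: "S \<in> \<Union>N" "s = card S"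
      by blast
    then have "finite S" "S \<noteq> {}" "S \<subset> {0..n}"
      using C[OF S(1)] finite_subset[of S "{0..n}"] by auto
    then have "0 < card S" "card S < card {0..n}"
      using psubset_card_mono[of "{0..n}" S] by (simp_all add: card_gt_0_iff)
    then show "s \<in> {1..n}"
      using S by simp
  qed
  have "finite (\<Union>N)"
    using finite_imageD[OF finite_subset[OF sizes] inj] by simp
  then have "card N \<le> card (\<Union>N)"
    using \<open>inj_on g N\<close> g(1) by (intro card_inj_on_le[of g]) blast+
  also have "\<dots> = card (card ` \<Union>N)"
    using inj by (simp add: card_image)
  also have "\<dots> \<le> n"
    using card_mono[OF _ sizes] by simp
  finally show ?thesis .
qed

text \<open>
  The starting points differ by at most the common length \<open>s\<close>, because blocks have \<open>s + 1\<close>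
  elements. So the two intervals of sizes overlap or are adjacent, and the union of the chains
  cannot be a non-saturated chain.
\<close>

lemma nested1_same_block_eq:
  assumes X: "X \<in> B1 n" and Y: "Y \<in> B1 n" and nested: "nested1 n {X, Y}"
    and size: "card X = card Y"
    and block: "(Min (card ` X) - 1) div (card X + 1) = (Min (card ` Y) - 1) div (card Y + 1)"
  shows "X = Y"
proof -
  obtain a b where a: "1 \<le> a" "a \<le> b" "card ` X = {a..b}" "card X = b + 1 - a" "Min (card ` X) = a"
    using B1_obtain_sizes[OF X] by metis
  obtain c d where c: "1 \<le> c" "c \<le> d" "card ` Y = {c..d}" "card Y = d + 1 - c" "Min (card ` Y) = c"
    using B1_obtain_sizes[OF Y] by metis
  define s where "s = card X"
  have same: "(a - 1) div (s + 1) = (c - 1) div (s + 1)"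
    using block size a c by (simp add: s_def)
  have "a - 1 = (a - 1) div (s + 1) * (s + 1) + (a - 1) mod (s + 1)"
       "c - 1 = (a - 1) div (s + 1) * (s + 1) + (c - 1) mod (s + 1)"
    by (simp only: div_mult_mod_eq, simp only: same div_mult_mod_eq)
  moreover have "(a - 1) mod (s + 1) \<le> s" "(c - 1) mod (s + 1) \<le> s"
    by (simp_all add: less_Suc_eq_le[symmetric])
  ultimately have "a - 1 \<le> c - 1 + s" "c - 1 \<le> a - 1 + s"
    by linarith+
  then have "c \<le> b + 1" "a \<le> d + 1"
    using a c size unfolding s_def by linarith+
  then have "X \<union> Y \<notin> C1 n - B1 n"
    using B1_Un_in_B1[OF X a(3) Y c(3)] by (auto simp: C1_def)
  then have "X \<subseteq> Y \<or> Y \<subseteq> X"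
    using nested nested1_pair_iff[OF X Y] by blast
  then show ?thesis
    using size card_seteq[of Y X] card_seteq[of X Y] B1_finite X Y by auto
qed

definition flag_interval :: "nat \<Rightarrow> nat \<Rightarrow> nat set set" where
  "flag_interval a b = (\<lambda>j. {0..<j}) ` {a..b}"

lemma card_flag_interval: "card ` flag_interval a b = {a..b}"
  by (simp add: flag_interval_def image_image)

lemma flag_interval_in_B1:
  assumes "1 \<le> a" "a \<le> b" "b \<le> n"
  shows "flag_interval a b \<in> B1 n"
proof -
  have "chain\<^sub>\<subseteq> (flag_interval a b)"
    by (auto simp: chain_subset_def flag_interval_def)
  moreover have "flag_interval a b \<subseteq> Pow {0..n}"
    using assms by (auto simp: flag_interval_def)
  ultimately show ?thesis
    unfolding B1_iff_saturated_chain card_flag_interval using assms by blast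
qed

lemma flag_intervals_nested:
  assumes "1 \<le> a" "a \<le> b" "b \<le> n" "1 \<le> c" "c \<le> d" "d \<le> n"
    and compat: "a \<le> c \<and> d \<le> b \<or> c \<le> a \<and> b \<le> d \<or> b + 1 < c \<or> d + 1 < a"
  shows "nested1 n {flag_interval a b, flag_interval c d}"
proof -
  have B: "flag_interval a b \<in> B1 n" "flag_interval c d \<in> B1 n"
    using assms by (auto intro: flag_interval_in_B1)
  consider "a \<le> c \<and> d \<le> b" | "c \<le> a \<and> b \<le> d" | "b + 1 < c \<or> d + 1 < a"
    using compat by blast
  then show ?thesis
  proof cases
    case 3
    have "flag_interval a b \<union> flag_interval c d \<in> C1 n"
    proof -
      have "chain\<^sub>\<subseteq> (flag_interval a b \<union> flag_interval c d)"
        unfolding chain_subset_def flag_interval_def by fastforce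
      moreover have "flag_interval a b \<in> C1 n" "flag_interval c d \<in> C1 n"
        using B B1_subset_C1 by blast+
      ultimately show ?thesis
        unfolding C1_def by blast
    qed
    moreover have "{a..b} \<union> {c..d} \<noteq> {x..y}" for x y
    proof
      assume eq: "{a..b} \<union> {c..d} = {x..y}"
      then have "\<And>j. j \<in> {x..y} \<longleftrightarrow> j \<in> {a..b} \<or> j \<in> {c..d}"
        by blast
      from this[of a] this[of b] this[of c] this[of d] this[of "b + 1"] this[of "d + 1"] show False
        using 3 assms by auto
    qed
    then have "flag_interval a b \<union> flag_interval c d \<notin> B1 n"
      unfolding B1_iff_saturated_chain image_Un card_flag_interval by blast
    ultimately show ?thesis
      using nested1_pair_iff[OF B] by blast
  qed (use nested1_pair_iff[OF B] in \<open>auto simp: flag_interval_def\<close>)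
qed

section \<open>Families of crossing intervals\<close>

text \<open>
  In a family of intervals any two of which cross or are adjacent, the left ends are distinct,
  the right ends are distinct, and no left end exceeds a right end by more than 1. Given a
  member \<open>{a..b}\<close>, the intervals starting at or after \<open>a\<close> are recorded by their left ends, the others by their right ends increased by 2;
  the increase makes the two kinds of values disjoint, and all of them fall into \<open>{a..b + 1}\<close>.
\<close>

lemma card_crossing_intervals_le:
  fixes I :: "(nat \<times> nat) set"
  assumes I: "\<And>a b. (a, b) \<in> I \<Longrightarrow> a \<le> b"
    and crossing: "\<And>a b c d. (a, b) \<in> I \<Longrightarrow> (c, d) \<in> I \<Longrightarrow> (a, b) \<noteq> (c, d) \<Longrightarrow>
        \<not> (a \<le> c \<and> d \<le> b) \<and> \<not> (b + 1 < c)"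
    and ab: "(a, b) \<in> I"
  shows "card I \<le> b + 2 - a"
proof -
  define g where "g = (\<lambda>(c, d). if a \<le> c then c else d + 2)"
  have adj: "c \<le> d' + 1" if "(c, d) \<in> I" "(c', d') \<in> I" for c d c' d'
    using crossing[OF that(2) that(1)] I[OF that(1)] by (cases "(c, d) = (c', d')") auto
  have "g ` I \<subseteq> {a..b + 1}"
  proof
    fix x assume "x \<in> g ` I"
    then obtain c d where cd: "(c, d) \<in> I" "x = g (c, d)"
      by auto
    then show "x \<in> {a..b + 1}"
      using adj[OF cd(1) ab] adj[OF ab cd(1)] crossing[OF cd(1) ab] I[OF ab]
      by (auto simp: g_def split: if_splits)
  qed
  moreover have "inj_on g I"
  proof (rule inj_onI, clarify)
    fix c d c' d' assume cd: "(c, d) \<in> I" and cd': "(c', d') \<in> I" and eq: "g (c, d) = g (c', d')"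
    show "c = c' \<and> d = d'"
      using eq adj[OF cd cd'] adj[OF cd' cd] crossing[OF cd cd'] crossing[OF cd' cd]
        nat_le_linear[of c c'] nat_le_linear[of d d']
      by (auto simp: g_def split: if_splits)
  qed
  ultimately have "card I \<le> card {a..b + 1}"
    by (intro card_inj_on_le) auto
  then show ?thesis
    by simp
qed

text \<open>
  By the previous bound, every member has weight at most \<open>1 / card I\<close>.
\<close>

lemma weight_crossing_intervals_le:
  fixes I :: "(nat \<times> nat) set"
  assumes I: "\<And>a b. (a, b) \<in> I \<Longrightarrow> a \<le> b"
    and crossing: "\<And>a b c d. (a, b) \<in> I \<Longrightarrow> (c, d) \<in> I \<Longrightarrow> (a, b) \<noteq> (c, d) \<Longrightarrow>
        \<not> (a \<le> c \<and> d \<le> b) \<and> \<not> (b + 1 < c)"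
  shows "(\<Sum>(a, b)\<in>I. 1 / real (b + 2 - a)) \<le> 1"
proof (cases "finite I \<and> I \<noteq> {}")
  case True
  then have pos: "card I > 0"
    by (simp add: card_gt_0_iff)
  have "(\<Sum>(a, b)\<in>I. 1 / real (b + 2 - a)) \<le> (\<Sum>p\<in>I. 1 / real (card I))"
  proof (rule sum_mono, clarify)
    fix a b assume "(a, b) \<in> I"
    then have "card I \<le> b + 2 - a"
      using card_crossing_intervals_le[of I] I crossing by blast
    then show "1 / real (b + 2 - a) \<le> 1 / real (card I)"
      using pos by (intro divide_left_mono) auto
  qed
  then show ?thesis
    using pos by simp
qed auto

lemma sum_inverse_Suc: "(\<Sum>s=1..n. 1 / real (s + 1)) = harm (n + 1) - 1"
proof (induction n)
  case (Suc n)
  then show ?case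
    using harm_Suc[of "Suc n", where ?'a = real] by (simp add: inverse_eq_divide)
qed (simp add: harm_def)

lemma sum_interval_weights:
  "(\<Sum>(a, b)\<in>{(a, b). 1 \<le> a \<and> a \<le> b \<and> b \<le> n}. 1 / real (b + 2 - a)) =
     (real n + 2) * (harm (n + 1) - 1) - real n"
proof -
  have "(\<Sum>(a, b)\<in>{(a, b). 1 \<le> a \<and> a \<le> b \<and> b \<le> n}. 1 / real (b + 2 - a)) =
        (\<Sum>(s, a)\<in>(SIGMA s:{1..n}. {1..n + 1 - s}). 1 / real (s + 1))"
    by (rule sum.reindex_bij_witness[where i = "\<lambda>(s, a). (a, a + s - 1)" and j = "\<lambda>(a, b). (b + 1 - a, a)"])
       (auto simp: Suc_diff_le)
  also have "\<dots> = (\<Sum>s=1..n. \<Sum>a=1..n + 1 - s. 1 / real (s + 1))"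
    by (subst sum.Sigma) auto
  also have "\<dots> = (\<Sum>s=1..n. (real n + 2) * (1 / real (s + 1)) - 1)"
  proof (rule sum.cong[OF refl])
    fix s assume "s \<in> {1..n}"
    then have "real (n + 1 - s) = real n + 1 - real s"
      by (simp add: of_nat_diff)
    then show "(\<Sum>a=1..n + 1 - s. 1 / real (s + 1)) = (real n + 2) * (1 / real (s + 1)) - 1"
      by (simp add: field_simps)
  qed
  also have "\<dots> = (real n + 2) * (harm (n + 1) - 1) - real n"
    by (simp only: sum_subtractf sum_distrib_left[symmetric] sum_inverse_Suc) simp
  finally show ?thesis .
qed

section \<open>Colouring the permutoassociahedron\<close>

lemma permutoassociahedron_facets:
  fixes P :: "'a::real_vector set"
  assumes "simple_permutoassociahedron n P"
  obtains \<psi> where "bij_betw \<psi> (B1 n) {F. is_facet F P}"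
    and "\<And>X Y. X \<in> B1 n \<Longrightarrow> Y \<in> B1 n \<Longrightarrow> separated_facets P (\<psi> X) (\<psi> Y) \<longleftrightarrow> \<not> nested1 n {X, Y}"
proof -
  have empty: "nested1 n {}"
    by (simp add: nested1_def antichain_in_def)
  have P: "simple_polytope n P" "realises P {N. nested1 n N}"
    using assms by (simp_all add: simple_permutoassociahedron_def)
  show thesis
  proof (rule facets_of_realised_complex[OF P])
    fix \<psi>
    assume bij: "bij_betw \<psi> {x. {x} \<in> {N. nested1 n N}} {F. is_facet F P}"
      and sep: "\<And>x y. {x} \<in> {N. nested1 n N} \<Longrightarrow> {y} \<in> {N. nested1 n N} \<Longrightarrow>
        separated_facets P (\<psi> x) (\<psi> y) = ({x, y} \<notin> {N. nested1 n N})"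
    show thesis
    proof (rule that)
      show "bij_betw \<psi> (B1 n) {F. is_facet F P}"
        using bij by (simp add: nested1_singleton_iff)
      show "separated_facets P (\<psi> X) (\<psi> Y) \<longleftrightarrow> \<not> nested1 n {X, Y}"
        if "X \<in> B1 n" "Y \<in> B1 n" for X Y
        using sep[of X Y] that by (simp add: nested1_singleton_iff)
    qed
  qed (use empty nested1_mono nested1_finite card_nested1_le in auto)
qed

text \<open>
  The colour of a saturated chain with sizes \<open>{a..b}\<close> depends only on its length
  \<open>s = b + 1 - a\<close> and on the block of \<open>s + 1\<close> consecutive numbers in which \<open>a\<close> lies. Within a
  block, two intervals of length \<open>s\<close> overlap or are adjacent, and this alone makes two distinct
  chains incompatible, however they sit in the Boolean lattice. The start \<open>a - 1\<close> runs through
  \<open>{0..n - s}\<close>, which meets \<open>(n - s) div (s + 1) + 1\<close> blocks.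
\<close>

lemma proper_colouring_by_size_and_block:
  fixes P :: "'a::real_vector set"
  assumes P: "simple_permutoassociahedron n P"
  shows "\<exists>f. proper_colouring P (\<Sum>s=1..n. (n - s) div (s + 1) + 1) f"
proof -
  obtain \<psi> where bij: "bij_betw \<psi> (B1 n) {F. is_facet F P}"
    and sep: "\<And>X Y. X \<in> B1 n \<Longrightarrow> Y \<in> B1 n \<Longrightarrow>
      separated_facets P (\<psi> X) (\<psi> Y) \<longleftrightarrow> \<not> nested1 n {X, Y}"
    using permutoassociahedron_facets[OF P] by blast
  define Q where "Q = (SIGMA s:{1..n}. {0..(n - s) div (s + 1)})"
  define m where "m = (\<Sum>s=1..n. (n - s) div (s + 1) + 1)"
  have "finite Q" "card Q = m"
    by (simp_all add: Q_def m_def)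
  then obtain e where e: "bij_betw e Q {1..m}"
    using finite_same_card_bij[of Q "{1..m}"] by auto
  define \<kappa> :: "nat set set \<Rightarrow> nat \<times> nat"
    where "\<kappa> X = (card X, (Min (card ` X) - 1) div (card X + 1))" for X
  have \<kappa>: "\<kappa> X \<in> Q" if X: "X \<in> B1 n" for X
  proof -
    obtain a b where a: "1 \<le> a" "a \<le> b" "b \<le> n" "card X = b + 1 - a" "Min (card ` X) = a"
      using B1_obtain_sizes[OF X] by metis
    then have "Min (card ` X) - 1 \<le> n - card X"
      by linarith
    then have "(Min (card ` X) - 1) div (card X + 1) \<le> (n - card X) div (card X + 1)"
      by (rule div_le_mono)
    moreover have "card X \<in> {1..n}"
      using a by auto
    ultimately show ?thesis
      by (simp add: Q_def \<kappa>_def)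
  qed
  define \<iota> where "\<iota> = inv_into (B1 n) \<psi>"
  have \<iota>: "\<iota> F \<in> B1 n" "\<psi> (\<iota> F) = F" if "is_facet F P" for F
    unfolding \<iota>_def
    using bij_betw_apply[OF bij_betw_inv_into[OF bij]] bij_betw_inv_into_right[OF bij] that by blast+
  have "proper_colouring P m (\<lambda>F. e (\<kappa> (\<iota> F)))"
    unfolding proper_colouring_def
  proof (intro conjI allI impI, goal_cases)
    case 1
    then show ?case
      using e \<iota>(1) \<kappa> unfolding bij_betw_def by blast
  next
    case (2 F G)
    then have F: "\<iota> F \<in> B1 n" "\<psi> (\<iota> F) = F" and G: "\<iota> G \<in> B1 n" "\<psi> (\<iota> G) = G"
      and ne: "F \<noteq> G" and same: "e (\<kappa> (\<iota> F)) = e (\<kappa> (\<iota> G))"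
      using \<iota> by blast+
    have "\<kappa> (\<iota> F) = \<kappa> (\<iota> G)"
      by (rule inj_onD[OF bij_betw_imp_inj_on[OF e] same \<kappa>[OF F(1)] \<kappa>[OF G(1)]])
    moreover have "\<iota> F \<noteq> \<iota> G"
      using ne F(2) G(2) by metis
    ultimately have "\<not> nested1 n {\<iota> F, \<iota> G}"
      using nested1_same_block_eq[OF F(1) G(1)] by (auto simp: \<kappa>_def)
    then show ?case
      using sep[OF F(1) G(1)] unfolding F(2) G(2) by blast
  qed
  then show ?thesis
    unfolding m_def by blast
qed

lemma chromatic_number_le:
  fixes P :: "'a::real_vector set"
  assumes P: "simple_permutoassociahedron n P"
  shows "real (chromatic_number P) \<le> (real n + 1) * (harm (n + 1) - 1)"
proof -
  have "chromatic_number P \<le> (\<Sum>s=1..n. (n - s) div (s + 1) + 1)"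
    unfolding chromatic_number_def by (rule Least_le) (rule proper_colouring_by_size_and_block[OF P])
  then have "real (chromatic_number P) \<le> real (\<Sum>s=1..n. (n - s) div (s + 1) + 1)"
    by (rule of_nat_mono)
  also have "\<dots> \<le> (\<Sum>s=1..n. (real n + 1) * (1 / real (s + 1)))"
    unfolding of_nat_sum
  proof (rule sum_mono)
    fix s assume s: "s \<in> {1..n}"
    have "real ((n - s) div (s + 1)) \<le> real (n - s) / real (s + 1)"
      by (rule of_nat_div_le_of_nat)
    also have "\<dots> = (real n + 1) * (1 / real (s + 1)) - 1"
      using s by (simp add: of_nat_diff field_simps)
    finally show "real ((n - s) div (s + 1) + 1) \<le> (real n + 1) * (1 / real (s + 1))"
      by simp
  qed
  also have "\<dots> = (real n + 1) * (harm (n + 1) - 1)"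
    by (simp only: sum_distrib_left[symmetric] sum_inverse_Suc)
  finally show ?thesis .
qed

text \<open>
  The chains inside the single flag \<open>{0..<1} \<subset> \<dots> \<subset> {0..<n}\<close> already force the leading
  term. By double counting, the total weight of all intervals is the sum over the colours of
  the weight of a colour class, and each class is a crossing family, of weight at most 1.
\<close>

lemma proper_colouring_lower_bound:
  fixes P :: "'a::real_vector set"
  assumes P: "simple_permutoassociahedron n P" and f: "proper_colouring P m f"
  shows "(real n + 2) * (harm (n + 1) - 1) - real n \<le> real m"
proof -
  obtain \<psi> where bij: "bij_betw \<psi> (B1 n) {F. is_facet F P}"
    and sep: "\<And>X Y. X \<in> B1 n \<Longrightarrow> Y \<in> B1 n \<Longrightarrow>
      separated_facets P (\<psi> X) (\<psi> Y) \<longleftrightarrow> \<not> nested1 n {X, Y}"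
    using permutoassociahedron_facets[OF P] by blast
  define J where "J = {(a, b). 1 \<le> a \<and> a \<le> b \<and> b \<le> n}"
  define \<kappa> where "\<kappa> = (\<lambda>(a, b). f (\<psi> (flag_interval a b)))"
  have B: "flag_interval a b \<in> B1 n" if "(a, b) \<in> J" for a b
    using that flag_interval_in_B1 by (simp add: J_def)
  have facet: "is_facet (\<psi> X) P" if "X \<in> B1 n" for X
    using bij that by (auto simp: bij_betw_def)
  have "finite J"
    by (rule finite_subset[of _ "{1..n} \<times> {1..n}"]) (auto simp: J_def)
  have range: "\<kappa> ` J \<subseteq> {1..m}"
    using f B facet unfolding proper_colouring_def \<kappa>_def by fastforce
  have class_weight: "(\<Sum>(a, b)\<in>{p \<in> J. \<kappa> p = i}. 1 / real (b + 2 - a)) \<le> 1" for i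
  proof (rule weight_crossing_intervals_le)
    fix a b c d
    assume ab: "(a, b) \<in> {p \<in> J. \<kappa> p = i}" and cd: "(c, d) \<in> {p \<in> J. \<kappa> p = i}"
      and ne: "(a, b) \<noteq> (c, d)"
    have X: "flag_interval a b \<in> B1 n" and Y: "flag_interval c d \<in> B1 n"
      using ab cd B by auto
    have "{a..b} \<noteq> {c..d}"
      using ab ne by (auto simp: J_def Icc_eq_Icc)
    then have "flag_interval a b \<noteq> flag_interval c d"
      by (metis card_flag_interval)
    then have "\<psi> (flag_interval a b) \<noteq> \<psi> (flag_interval c d)"
      using inj_onD[OF bij_betw_imp_inj_on[OF bij] _ X Y] by blast
    moreover have "f (\<psi> (flag_interval a b)) = f (\<psi> (flag_interval c d))"
      using ab cd by (simp add: \<kappa>_def)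
    ultimately have "separated_facets P (\<psi> (flag_interval a b)) (\<psi> (flag_interval c d))"
      using f facet[OF X] facet[OF Y] by (simp add: proper_colouring_def)
    then have "\<not> nested1 n {flag_interval a b, flag_interval c d}"
      using sep[OF X Y] by simp
    then show "\<not> (a \<le> c \<and> d \<le> b) \<and> \<not> (b + 1 < c)"
      using flag_intervals_nested[of a b n c d] ab cd by (auto simp: J_def)
  qed (simp add: J_def)
  have "(real n + 2) * (harm (n + 1) - 1) - real n = (\<Sum>(a, b)\<in>J. 1 / real (b + 2 - a))"
    unfolding J_def by (rule sum_interval_weights[symmetric])
  also have "\<dots> = (\<Sum>i\<in>{1..m}. \<Sum>(a, b)\<in>{p \<in> J. \<kappa> p = i}. 1 / real (b + 2 - a))"
    by (rule sum.group[OF \<open>finite J\<close> _ range, symmetric]) simp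
  also have "\<dots> \<le> (\<Sum>i\<in>{1..m}. 1)"
    by (rule sum_mono) (rule class_weight)
  finally show ?thesis
    by simp
qed

lemma chromatic_number_ge:
  fixes P :: "'a::real_vector set"
  assumes P: "simple_permutoassociahedron n P"
  shows "(real n + 2) * (harm (n + 1) - 1) - real n \<le> real (chromatic_number P)"
proof -
  have "\<exists>f. proper_colouring P (chromatic_number P) f"
    unfolding chromatic_number_def
    using proper_colouring_by_size_and_block[OF P] by (rule LeastI)
  then show ?thesis
    using proper_colouring_lower_bound[OF P] by blast
qed

section \<open>Asymptotics\<close>

lemma harm_Suc_over_ln: "(\<lambda>n. (harm (n + 1) - 1) / ln (real n)) \<longlonglongrightarrow> 1"
proof -
  have "(\<lambda>n. harm (n + 1) - ln (real (n + 1))) \<longlonglongrightarrow> (euler_mascheroni :: real)"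
    using LIMSEQ_ignore_initial_segment[OF euler_mascheroni_LIMSEQ, of 1] by simp
  moreover have "(\<lambda>n. 1 / ln (real n)) \<longlonglongrightarrow> 0"
    by real_asymp
  moreover have "(\<lambda>n. ln (real (n + 1)) / ln (real n)) \<longlonglongrightarrow> 1"
    by real_asymp
  ultimately have "(\<lambda>n. (harm (n + 1) - ln (real (n + 1)) - 1) * (1 / ln (real n))
      + ln (real (n + 1)) / ln (real n)) \<longlonglongrightarrow> (euler_mascheroni - 1) * 0 + 1"
    by (intro tendsto_intros)
  moreover have "(harm (n + 1) - ln (real (n + 1)) - 1) * (1 / ln (real n))
      + ln (real (n + 1)) / ln (real n) = (harm (n + 1) - 1) / ln (real n)" for n
    by (simp add: diff_divide_distrib)
  ultimately show ?thesis
    by simp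
qed

theorem corollary7p6:
  fixes PA :: "nat \<Rightarrow> (nat \<Rightarrow>\<^sub>0 real) set"
  assumes "\<And>n. 1 \<le> n \<Longrightarrow> simple_permutoassociahedron n (PA n)"
  shows "(\<lambda>n. real (chromatic_number (PA n)) / (real n * ln (real n))) \<longlonglongrightarrow> 1"
proof (rule tendsto_sandwich)
  have pos: "0 \<le> real n * ln (real n)" for n
    by (cases "n = 0") auto
  show "\<forall>\<^sub>F n in sequentially. ((real n + 2) * (harm (n + 1) - 1) - real n) / (real n * ln (real n))
      \<le> real (chromatic_number (PA n)) / (real n * ln (real n))"
    using eventually_ge_at_top[of 1]
    by eventually_elim (intro divide_right_mono chromatic_number_ge assms pos)
  show "\<forall>\<^sub>F n in sequentially. real (chromatic_number (PA n)) / (real n * ln (real n))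
      \<le> (real n + 1) * (harm (n + 1) - 1) / (real n * ln (real n))"
    using eventually_ge_at_top[of 1]
    by eventually_elim (intro divide_right_mono chromatic_number_le assms pos)
  have "(\<lambda>n. (real n + 1) / real n) \<longlonglongrightarrow> 1"
    by real_asymp
  from tendsto_mult[OF this harm_Suc_over_ln]
  show "(\<lambda>n. (real n + 1) * (harm (n + 1) - 1) / (real n * ln (real n))) \<longlonglongrightarrow> 1"
    by simp
  have "(\<lambda>n. (real n + 2) / real n) \<longlonglongrightarrow> 1" "(\<lambda>n. real n / (real n * ln (real n))) \<longlonglongrightarrow> 0"
    by real_asymp+
  from tendsto_diff[OF tendsto_mult[OF this(1) harm_Suc_over_ln] this(2)]
  show "(\<lambda>n. ((real n + 2) * (harm (n + 1) - 1) - real n) / (real n * ln (real n))) \<longlonglongrightarrow> 1"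
    by (simp add: diff_divide_distrib[of "_ * _"])
qed

end
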